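(* Let $\phi$ be an $\textit{LTL}_f$ formula and $\eta=\omega_0\ldots\omega_n\in\Sigma^*$ ($n\ge 0$) a finite trace. Then $\eta\models\phi$ iff there exists a run $s_0\xrightarrow{\alpha_0}s_1\cdots s_n\xrightarrow{\alpha_n}s_{n+1}$ of $T_\phi$ on $\eta$ whose final transition $s_n\xrightarrow{\alpha_n}s_{n+1}$ satisfies $\omega_{\alpha_n}\models s_n$. Consequently, $\phi$ is satisfiable iff some state $\psi_1$ reachable from $\phi$ in $T_\phi$ has a transition $\psi_1\xrightarrow{\alpha}\psi_2$ with $\omega_\alpha\models\psi_1$.
   Context: Fix a finite set $\mathcal{P}$ of atomic propositions; $L=\mathcal{P}\cup\{\neg a: a\in\mathcal{P}\}$ is the set of literals and $\Sigma=2^{L}$. $\textit{LTL}_f$ formulas are in negation normal form: $\phi::=\mathsf{tt}\mid\mathsf{ff}\mid \ell\mid \phi\wedge\phi\mid\phi\vee\phi\mid X\phi\mid X_w\phi\mid \phi U\phi\mid\phi R\phi$, $\ell\in L$. A finite trace is $\eta=\omega_0\ldots\omega_n\in\Sigma^*$ ($n\ge0$), $|\eta|=n+1$, $\eta_i=\omega_i\ldots\omega_n$. Satisfaction: $\eta\models\mathsf{tt}$, $\eta\not\models\mathsf{ff}$; $\eta\models\ell$ iff $\ell\in\omega_0$; $\wedge,\vee$ as usual; $\eta\models X\psi$ iff $|\eta|>1$ and $\eta_1\models\psi$; $\eta\models X_w\psi$ iff $|\eta|=1$ or ($|\eta|>1$ and $\eta_1\models\psi$); $\eta\models\phi_1U\phi_2$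 iff some $0\le i<|\eta|$ has $\eta_i\models\phi_2$ and $\eta_j\models\phi_1$ for all $j<i$; $\eta\models\phi_1R\phi_2$ iff either $\eta_i\models\phi_2$ for all $0\le i<|\eta|$, or some $0\le i<|\eta|$ has $\eta_i\models\phi_1$ and $\eta_j\models\phi_2$ for all $j\le i$. $\phi$ is satisfiable iff some finite trace satisfies it. A letter $\omega\in\Sigma$ is identified with the length-one trace $\omega$. $CF(\phi)$ is the set of conjuncts of $\phi$ and $DF(\phi)$ its set of disjuncts. Normal form $\mathit{NF}(\phi)$ (a set of clauses $\alpha\wedge X(\psi)$): $\mathit{NF}(\mathsf{ff})=\emptyset$; $\mathit{NF}(\phi)=\{\phi\wedge X(\mathsf{tt})\}$ if $\phi$ is $\mathsf{tt}$ or a literal; $\mathit{NF}(X\phi)=\mathit{NF}(X_w\phi)=\{\mathsf{tt}\wedge X(\psi)\mid\psi\in DF(\phi)\}$; $\mathit{NF}(\phi_1U\phi_2)=\mathit{NF}(\phi_2)\cup\mathit{NF}(\phi_1\wedge X(\phi_1U\phi_2))$; $\mathit{NF}(\phi_1R\phi_2)=\mathit{NF}(\phi_1\wedge\phi_2)\cup\mathit{NF}(\phi_2\wedge X(\phi_1R\phi_2))$; $\mathit{NF}(\phi_1\vee\phi_2)=\mathit{NF}(\phi_1)\cup\mathit{NF}(\phi_2)$; $\mathit{NF}(\phi_1\wedge\phi_2)=\{(\alpha_1\wedge\alpha_2)\wedge X(\psi_1\wedge\psi_2)\mid \alpha_i\wedge X(\psi_i)\in\mathit{NF}(\phi_i)\}$.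 Every label $\alpha$ is a conjunction of literals and $\mathsf{tt}$; $\omega_\alpha\in\Sigma$ is the set of literals among its conjuncts $CF(\alpha)$. $T_\phi$: initial state $\phi$; transitions $\psi_1\xrightarrow{\alpha}\psi_2$ iff $\alpha\wedge X(\psi_2)\in\mathit{NF}(\psi_1)$; states form the smallest set containing $\phi$ closed under transitions. A run of $T_\phi$ on $\eta=\omega_0\ldots\omega_n$ is a sequence of transitions $s_0\xrightarrow{\alpha_0}s_1\cdots s_n\xrightarrow{\alpha_n}s_{n+1}$ with $s_0=\phi$ and $\omega_i\models\alpha_i$ for all $i$; $\psi$ is reachable from $\phi$ if some run ends in $\psi$ (including $\phi$ itself). *)

theory Defs
  imports Main
begin

datatype 'a literal = Pos 'a | Neg 'a

datatype 'a ltlf =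
    TT
  | FF
  | Lit "'a literal"
  | And "'a ltlf" "'a ltlf"
  | Or "'a ltlf" "'a ltlf"
  | Next "'a ltlf"
  | WNext "'a ltlf"
  | Until "'a ltlf" "'a ltlf"
  | Release "'a ltlf" "'a ltlf"

definition literals :: "'a set \<Rightarrow> 'a literal set" where
  "literals P = Pos ` P \<union> Neg ` P"

text \<open>Letters are arbitrary sets of literals: a letter may contain both, or neither, of an
  atom and its negation.\<close>

definition letters :: "'a set \<Rightarrow> 'a literal set set" where
  "letters P = Pow (literals P)"

definition traces :: "'a set \<Rightarrow> 'a literal set list set" where
  "traces P = {\<eta>. \<eta> \<noteq> [] \<and> set \<eta> \<subseteq> letters P}"

definition formulas :: "'a set \<Rightarrow> 'a ltlf set" where
  "formulas P = {\<phi>. set_ltlf \<phi> \<subseteq> P}"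

text \<open>The suffix starting at position \<open>i\<close> is \<^term>\<open>drop i \<eta>\<close>. Satisfaction is only
  meaningful for nonempty lists.\<close>

primrec sat :: "'a literal set list \<Rightarrow> 'a ltlf \<Rightarrow> bool" (infix \<open>\<Turnstile>\<close> 50) where
  "\<eta> \<Turnstile> TT \<longleftrightarrow> True"
| "\<eta> \<Turnstile> FF \<longleftrightarrow> False"
| "\<eta> \<Turnstile> Lit l \<longleftrightarrow> l \<in> hd \<eta>"
| "\<eta> \<Turnstile> And \<phi>1 \<phi>2 \<longleftrightarrow> \<eta> \<Turnstile> \<phi>1 \<and> \<eta> \<Turnstile> \<phi>2"
| "\<eta> \<Turnstile> Or \<phi>1 \<phi>2 \<longleftrightarrow> \<eta> \<Turnstile> \<phi>1 \<or> \<eta> \<Turnstile> \<phi>2"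
| "\<eta> \<Turnstile> Next \<psi> \<longleftrightarrow> length \<eta> > 1 \<and> drop 1 \<eta> \<Turnstile> \<psi>"
| "\<eta> \<Turnstile> WNext \<psi> \<longleftrightarrow> length \<eta> = 1 \<or> length \<eta> > 1 \<and> drop 1 \<eta> \<Turnstile> \<psi>"
| "\<eta> \<Turnstile> Until \<phi>1 \<phi>2 \<longleftrightarrow>
     (\<exists>i<length \<eta>. drop i \<eta> \<Turnstile> \<phi>2 \<and> (\<forall>j<i. drop j \<eta> \<Turnstile> \<phi>1))"
| "\<eta> \<Turnstile> Release \<phi>1 \<phi>2 \<longleftrightarrow>
     (\<forall>i<length \<eta>. drop i \<eta> \<Turnstile> \<phi>2) \<or>
     (\<exists>i<length \<eta>. drop i \<eta> \<Turnstile> \<phi>1 \<and> (\<forall>j\<le>i. drop j \<eta> \<Turnstile> \<phi>2))"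

definition satisfiable :: "'a set \<Rightarrow> 'a ltlf \<Rightarrow> bool" where
  "satisfiable P \<phi> \<longleftrightarrow> (\<exists>\<eta>\<in>traces P. \<eta> \<Turnstile> \<phi>)"

text \<open>Conjuncts and disjuncts are flattened through nested \<^const>\<open>And\<close> and \<^const>\<open>Or\<close>; a formula
  with another root operator, including \<^const>\<open>TT\<close> and \<^const>\<open>FF\<close>, is its own only conjunct
  (disjunct).\<close>

fun CF :: "'a ltlf \<Rightarrow> 'a ltlf set" where
  "CF (And \<phi>1 \<phi>2) = CF \<phi>1 \<union> CF \<phi>2"
| "CF \<phi> = {\<phi>}"

fun DF :: "'a ltlf \<Rightarrow> 'a ltlf set" where
  "DF (Or \<phi>1 \<phi>2) = DF \<phi>1 \<union> DF \<phi>2"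
| "DF \<phi> = {\<phi>}"

text \<open>A clause \<open>\<alpha> \<and> X(\<psi>)\<close> of the normal form is represented by the pair \<open>(\<alpha>, \<psi>)\<close>.\<close>

function NF :: "'a ltlf \<Rightarrow> ('a ltlf \<times> 'a ltlf) set" where
  "NF FF = {}"
| "NF TT = {(TT, TT)}"
| "NF (Lit l) = {(Lit l, TT)}"
| "NF (Next \<phi>) = {(TT, \<psi>) | \<psi>. \<psi> \<in> DF \<phi>}"
| "NF (WNext \<phi>) = {(TT, \<psi>) | \<psi>. \<psi> \<in> DF \<phi>}"
| "NF (Until \<phi>1 \<phi>2) = NF \<phi>2 \<union> NF (And \<phi>1 (Next (Until \<phi>1 \<phi>2)))"
| "NF (Release \<phi>1 \<phi>2) = NF (And \<phi>1 \<phi>2) \<union> NF (And \<phi>2 (Next (Release \<phi>1 \<phi>2)))"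
| "NF (Or \<phi>1 \<phi>2) = NF \<phi>1 \<union> NF \<phi>2"
| "NF (And \<phi>1 \<phi>2) =
     {(And \<alpha>1 \<alpha>2, And \<psi>1 \<psi>2) | \<alpha>1 \<psi>1 \<alpha>2 \<psi>2. (\<alpha>1, \<psi>1) \<in> NF \<phi>1 \<and> (\<alpha>2, \<psi>2) \<in> NF \<phi>2}"
  by pat_completeness auto

text \<open>Termination measure for \<^const>\<open>NF\<close>, which does not recurse below next operators.\<close>

primrec NF_size :: "'a ltlf \<Rightarrow> nat" where
  "NF_size TT = 1"
| "NF_size FF = 1"
| "NF_size (Lit l) = 1"
| "NF_size (And \<phi>1 \<phi>2) = NF_size \<phi>1 + NF_size \<phi>2 + 1"
| "NF_size (Or \<phi>1 \<phi>2) = NF_size \<phi>1 + NF_size \<phi>2 + 1"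
| "NF_size (Next \<phi>) = 1"
| "NF_size (WNext \<phi>) = 1"
| "NF_size (Until \<phi>1 \<phi>2) = NF_size \<phi>1 + NF_size \<phi>2 + 3"
| "NF_size (Release \<phi>1 \<phi>2) = NF_size \<phi>1 + NF_size \<phi>2 + 3"

termination NF
  by (relation "measure NF_size") auto

definition letter_of :: "'a ltlf \<Rightarrow> 'a literal set" where
  "letter_of \<alpha> = {l. Lit l \<in> CF \<alpha>}"

text \<open>The transition system \<open>T\<^sub>\<phi>\<close>: its states and its transitions between them.\<close>

inductive_set states :: "'a ltlf \<Rightarrow> 'a ltlf set" for \<phi> where
  init: "\<phi> \<in> states \<phi>"
| step: "\<lbrakk>\<psi>1 \<in> states \<phi>; (\<alpha>, \<psi>2) \<in> NF \<psi>1\<rbrakk> \<Longrightarrow> \<psi>2 \<in> states \<phi>"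

definition transition :: "'a ltlf \<Rightarrow> 'a ltlf \<Rightarrow> 'a ltlf \<Rightarrow> 'a ltlf \<Rightarrow> bool" where
  "transition \<phi> \<psi>1 \<alpha> \<psi>2 \<longleftrightarrow> \<psi>1 \<in> states \<phi> \<and> \<psi>2 \<in> states \<phi> \<and> (\<alpha>, \<psi>2) \<in> NF \<psi>1"

text \<open>A run on \<open>\<omega>\<^sub>0 \<dots> \<omega>\<^sub>n\<close> is given by its list of states \<open>s\<^sub>0, \<dots>, s\<^sub>n\<^sub>+\<^sub>1\<close> and its list of labels
  \<open>\<alpha>\<^sub>0, \<dots>, \<alpha>\<^sub>n\<close>.\<close>

definition is_run ::
  "'a ltlf \<Rightarrow> 'a literal set list \<Rightarrow> 'a ltlf list \<Rightarrow> 'a ltlf list \<Rightarrow> bool" where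
  "is_run \<phi> \<eta> s \<alpha> \<longleftrightarrow>
     length s = length \<eta> + 1 \<and> length \<alpha> = length \<eta> \<and> s ! 0 = \<phi> \<and>
     (\<forall>i<length \<eta>. transition \<phi> (s ! i) (\<alpha> ! i) (s ! (i + 1)) \<and> [\<eta> ! i] \<Turnstile> \<alpha> ! i)"

definition reachable :: "'a set \<Rightarrow> 'a ltlf \<Rightarrow> 'a ltlf \<Rightarrow> bool" where
  "reachable P \<phi> \<psi> \<longleftrightarrow> \<psi> = \<phi> \<or> (\<exists>\<eta>\<in>traces P. \<exists>s \<alpha>. is_run \<phi> \<eta> s \<alpha> \<and> last s = \<psi>)"

end

theory Submission imports Defs begin

text \<open>On traces of length at least two, the normal form is an equivalent expansion of the formula
  into clauses \<open>\<alpha> \<and> X(\<psi>)\<close>, so satisfaction can be pushed along transitions one letter at a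
  time until a single letter is left. On that letter \<open>\<omega>\<close>, the labels \<open>\<alpha>\<close> satisfied by \<open>\<omega>\<close> are
  those with \<open>\<omega>\<^sub>\<alpha> \<subseteq> \<omega>\<close>; since formulas are in negation normal form and literals are tested by
  membership, satisfaction is monotone in \<open>\<omega>\<close>, so that \<open>\<omega>\<^sub>\<alpha>\<close> can stand in for \<open>\<omega>\<close>.\<close>

section \<open>Satisfaction: monotonicity and unfolding along the trace\<close>

lemma sat_singleton_mono: "[\<omega>] \<Turnstile> \<phi> \<Longrightarrow> \<omega> \<subseteq> \<omega>' \<Longrightarrow> [\<omega>'] \<Turnstile> \<phi>"
  by (induction \<phi>) auto

text \<open>Position 0 is split off the quantifiers. This law and the one for \<open>Release\<close>
  also cover an empty \<open>\<eta>\<close>: no positions remain there, so \<open>Until\<close> is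
  false and \<open>Release\<close> is true.\<close>

lemma sat_Until_Cons:
  "(\<omega> # \<eta>) \<Turnstile> Until \<phi>1 \<phi>2 \<longleftrightarrow> (\<omega> # \<eta>) \<Turnstile> \<phi>2 \<or> (\<omega> # \<eta>) \<Turnstile> \<phi>1 \<and> \<eta> \<Turnstile> Until \<phi>1 \<phi>2"
  by (simp add: Ex_less_Suc2 All_less_Suc2) blast

lemma sat_Release_Cons:
  "(\<omega> # \<eta>) \<Turnstile> Release \<phi>1 \<phi>2 \<longleftrightarrow>
     (\<omega> # \<eta>) \<Turnstile> \<phi>2 \<and> ((\<omega> # \<eta>) \<Turnstile> \<phi>1 \<or> \<eta> \<Turnstile> Release \<phi>1 \<phi>2)"
  by (simp add: Ex_less_Suc2 All_less_Suc2 less_Suc_eq_le[symmetric]) blast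

lemma sat_DF: "\<eta> \<Turnstile> \<phi> \<longleftrightarrow> (\<exists>\<psi>\<in>DF \<phi>. \<eta> \<Turnstile> \<psi>)"
  by (induction \<phi> rule: DF.induct) auto

lemma DF_nonempty: "DF \<phi> \<noteq> {}"
  by (induction \<phi> rule: DF.induct) auto

section \<open>Labels and clauses of the normal form\<close>

lemma letter_of_simps [simp]:
  "letter_of TT = {}"
  "letter_of (Lit l) = {l}"
  "letter_of (And \<alpha>1 \<alpha>2) = letter_of \<alpha>1 \<union> letter_of \<alpha>2"
  by (auto simp: letter_of_def)

text \<open>Labels produced by \<open>NF\<close> are built from literals and \<open>TT\<close> by
  \<open>And\<close> alone, so they demand nothing beyond their literals.\<close>

lemma sat_label_iff: "(\<alpha>, \<psi>) \<in> NF \<phi> \<Longrightarrow> [\<omega>] \<Turnstile> \<alpha> \<longleftrightarrow> letter_of \<alpha> \<subseteq> \<omega>"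
proof (induction \<phi> arbitrary: \<alpha> \<psi> rule: NF.induct)
  \<comment> \<open>Only one equation is unfolded here and for \<open>Release\<close>, so that the
    \<open>And\<close> formulas stay intact and match the induction hypotheses.\<close>
  case (6 \<phi>1 \<phi>2)
  then show ?case by (simp only: NF.simps(6)) blast
next
  case (7 \<phi>1 \<phi>2)
  then show ?case by (simp only: NF.simps(7)) blast
qed auto

text \<open>\<open>NF\<close> gives \<open>Next\<close> and \<open>WNext\<close> the same clauses,
  which is right only if a next letter exists; hence \<open>\<eta> \<noteq> []\<close>.\<close>

lemma sat_Cons_iff_NF:
  assumes "\<eta> \<noteq> []"
  shows "(\<omega> # \<eta>) \<Turnstile> \<phi> \<longleftrightarrow> (\<exists>\<alpha> \<psi>. (\<alpha>, \<psi>) \<in> NF \<phi> \<and> [\<omega>] \<Turnstile> \<alpha> \<and> \<eta> \<Turnstile> \<psi>)"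
proof (induction \<phi> rule: NF.induct)
  case (4 \<phi>)
  then show ?case using assms sat_DF[of \<eta> \<phi>] by auto
next
  case (5 \<phi>)
  then show ?case using assms sat_DF[of \<eta> \<phi>] by auto
next
  case (6 \<phi>1 \<phi>2)
  have "(\<omega> # \<eta>) \<Turnstile> Until \<phi>1 \<phi>2 \<longleftrightarrow>
      (\<omega> # \<eta>) \<Turnstile> \<phi>2 \<or> (\<omega> # \<eta>) \<Turnstile> And \<phi>1 (Next (Until \<phi>1 \<phi>2))"
    using assms by (simp only: sat_Until_Cons sat.simps(4,6)) simp
  then show ?case by (simp only: 6 NF.simps(6)) blast
next
  case (7 \<phi>1 \<phi>2)
  have "(\<omega> # \<eta>) \<Turnstile> Release \<phi>1 \<phi>2 \<longleftrightarrow>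
      (\<omega> # \<eta>) \<Turnstile> And \<phi>1 \<phi>2 \<or> (\<omega> # \<eta>) \<Turnstile> And \<phi>2 (Next (Release \<phi>1 \<phi>2))"
    using assms by (simp only: sat_Release_Cons sat.simps(4,6)) auto
  then show ?case by (simp only: 7 NF.simps(7)) blast
next
  case (8 \<phi>1 \<phi>2)
  then show ?case by auto
next
  case (9 \<phi>1 \<phi>2)
  have "(\<omega> # \<eta>) \<Turnstile> And \<phi>1 \<phi>2 \<longleftrightarrow> (\<omega> # \<eta>) \<Turnstile> \<phi>1 \<and> (\<omega> # \<eta>) \<Turnstile> \<phi>2" by simp
  then show ?case by (simp only: 9) fastforce
qed auto

text \<open>Each case picks a clause whose label alone records enough literals to make the formula
  true on one letter; \<open>Next\<close> cannot hold there.\<close>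

lemma sat_singleton_imp_NF:
  "[\<omega>] \<Turnstile> \<phi> \<Longrightarrow> \<exists>\<alpha> \<psi>. (\<alpha>, \<psi>) \<in> NF \<phi> \<and> [\<omega>] \<Turnstile> \<alpha> \<and> [letter_of \<alpha>] \<Turnstile> \<phi>"
proof (induction \<phi>)
  case (And \<phi>1 \<phi>2)
  then obtain \<alpha>1 \<psi>1 \<alpha>2 \<psi>2 where
    1: "(\<alpha>1, \<psi>1) \<in> NF \<phi>1" "[\<omega>] \<Turnstile> \<alpha>1" "[letter_of \<alpha>1] \<Turnstile> \<phi>1" and
    2: "(\<alpha>2, \<psi>2) \<in> NF \<phi>2" "[\<omega>] \<Turnstile> \<alpha>2" "[letter_of \<alpha>2] \<Turnstile> \<phi>2"
    by auto
  then have "(And \<alpha>1 \<alpha>2, And \<psi>1 \<psi>2) \<in> NF (And \<phi>1 \<phi>2)" "[\<omega>] \<Turnstile> And \<alpha>1 \<alpha>2" by auto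
  moreover have "[letter_of (And \<alpha>1 \<alpha>2)] \<Turnstile> And \<phi>1 \<phi>2"
    using 1(3) 2(3) by (auto intro: sat_singleton_mono)
  ultimately show ?case by blast
next
  case (Until \<phi>1 \<phi>2)
  then have "[\<omega>] \<Turnstile> \<phi>2" by simp
  with Until.IH(2) show ?case by auto
next
  case (Release \<phi>1 \<phi>2)
  then have "[\<omega>] \<Turnstile> \<phi>2" by auto
  with Release.IH(2) obtain \<alpha> \<psi> where
    *: "(\<alpha>, \<psi>) \<in> NF \<phi>2" "[\<omega>] \<Turnstile> \<alpha>" "[letter_of \<alpha>] \<Turnstile> \<phi>2"
    by blast
  \<comment> \<open>A clause of \<open>And \<phi>2 (Next (Release \<phi>1 \<phi>2))\<close>, with
    \<open>TT\<close> contributed by the \<open>Next\<close> conjunct. It fits whether or not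
    \<open>\<phi>1\<close> holds, since on one letter \<open>Release\<close> amounts to
    \<open>\<phi>2\<close>.\<close>
  then have "(And \<alpha> TT, And \<psi> (Release \<phi>1 \<phi>2)) \<in> NF (Release \<phi>1 \<phi>2)" by auto
  moreover have "[\<omega>] \<Turnstile> And \<alpha> TT" "[letter_of (And \<alpha> TT)] \<Turnstile> Release \<phi>1 \<phi>2"
    using * by auto
  ultimately show ?case by blast
next
  case (Or \<phi>1 \<phi>2)
  then show ?case by auto
next
  case (WNext \<phi>)
  \<comment> \<open>Any disjunct will do: \<open>WNext\<close> holds on every one-letter trace, even
    on the empty letter of \<open>TT\<close>.\<close>
  from DF_nonempty obtain \<psi> where "\<psi> \<in> DF \<phi>" by blast
  then have "(TT, \<psi>) \<in> NF (WNext \<phi>)" by simp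
  moreover have "[\<omega>] \<Turnstile> TT" "[letter_of TT] \<Turnstile> WNext \<phi>" by simp_all
  ultimately show ?case by blast
qed simp_all

text \<open>The condition on \<open>letter_of \<alpha>\<close> rejects clauses that merely postpone
  an obligation: those of \<open>Next \<phi>\<close> have label \<open>TT\<close>, but the empty
  letter does not satisfy \<open>Next \<phi>\<close>.\<close>

lemma sat_singleton_iff_NF:
  "[\<omega>] \<Turnstile> \<phi> \<longleftrightarrow> (\<exists>\<alpha> \<psi>. (\<alpha>, \<psi>) \<in> NF \<phi> \<and> [\<omega>] \<Turnstile> \<alpha> \<and> [letter_of \<alpha>] \<Turnstile> \<phi>)"
  using sat_singleton_imp_NF sat_singleton_mono sat_label_iff by metis

section \<open>Runs as paths through the normal form\<close>

lemma is_run_iff_NF: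
  "is_run \<phi> \<eta> s \<alpha> \<longleftrightarrow>
     length s = length \<eta> + 1 \<and> length \<alpha> = length \<eta> \<and> s ! 0 = \<phi> \<and>
     (\<forall>i<length \<eta>. (\<alpha> ! i, s ! (i + 1)) \<in> NF (s ! i) \<and> [\<eta> ! i] \<Turnstile> \<alpha> ! i)"
  (is "_ \<longleftrightarrow> ?R")
proof
  assume R: ?R
  \<comment> \<open>Steps starting at \<open>\<phi>\<close> never leave the states, so membership in
    \<open>states \<phi>\<close> comes for free.\<close>
  have "s ! i \<in> states \<phi>" if "i \<le> length \<eta>" for i
    using that
  proof (induction i)
    case 0
    with R show ?case by (auto intro: states.init)
  next
    case (Suc i)
    then have "s ! i \<in> states \<phi>" "(\<alpha> ! i, s ! Suc i) \<in> NF (s ! i)"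
      using R by auto
    then show ?case by (rule states.step)
  qed
  with R show "is_run \<phi> \<eta> s \<alpha>" by (auto simp: is_run_def transition_def)
qed (auto simp: is_run_def transition_def)

lemma is_run_Nil: "is_run \<phi> [] s \<alpha> \<longleftrightarrow> s = [\<phi>] \<and> \<alpha> = []"
  by (auto simp: is_run_iff_NF length_Suc_conv)

text \<open>The tail is a run of the system started at the second state; by
  \<open>is_run_iff_NF\<close> the initial formula matters only as \<open>s ! 0\<close>.\<close>

lemma is_run_Cons:
  "is_run \<phi> (\<omega> # \<eta>) s \<alpha> \<longleftrightarrow>
     (\<exists>s' a \<alpha>'. s = \<phi> # s' \<and> \<alpha> = a # \<alpha>' \<and> (a, hd s') \<in> NF \<phi> \<and> [\<omega>] \<Turnstile> a \<and>
        is_run (hd s') \<eta> s' \<alpha>')"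
proof (cases "length s = length \<eta> + 2 \<and> length \<alpha> = length \<eta> + 1")
  case True
  then obtain \<phi>' \<psi> s' a \<alpha>' where "s = \<phi>' # \<psi> # s'" "\<alpha> = a # \<alpha>'"
    by (auto simp: length_Suc_conv numeral_2_eq_2)
  with True show ?thesis by (auto simp: is_run_iff_NF All_less_Suc2)
next
  case False
  then show ?thesis by (auto simp: is_run_iff_NF)
qed

text \<open>\<open>\<phi>\<close> is generalized because removing the first letter passes to a
  successor state. \<open>sat_Cons_iff_NF\<close> handles every letter but the last,
  \<open>sat_singleton_iff_NF\<close> the last.\<close>

lemma sat_iff_run:
  "length \<eta> = n + 1 \<Longrightarrow>
     \<eta> \<Turnstile> \<phi> \<longleftrightarrow> (\<exists>s \<alpha>. is_run \<phi> \<eta> s \<alpha> \<and> [letter_of (\<alpha> ! n)] \<Turnstile> s ! n)"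
proof (induction n arbitrary: \<eta> \<phi>)
  case 0
  then obtain \<omega> where \<eta>: "\<eta> = [\<omega>]" by (auto simp: length_Suc_conv)
  have "(\<exists>s \<alpha>. is_run \<phi> \<eta> s \<alpha> \<and> [letter_of (\<alpha> ! 0)] \<Turnstile> s ! 0) \<longleftrightarrow>
      (\<exists>\<alpha> \<psi>. (\<alpha>, \<psi>) \<in> NF \<phi> \<and> [\<omega>] \<Turnstile> \<alpha> \<and> [letter_of \<alpha>] \<Turnstile> \<phi>)"
    (is "?L \<longleftrightarrow> ?R")
  proof
    assume ?L
    then show ?R by (auto simp: \<eta> is_run_Cons is_run_Nil)
  next
    assume ?R
    then obtain \<alpha> \<psi> where "is_run \<phi> \<eta> [\<phi>, \<psi>] [\<alpha>]" "[letter_of \<alpha>] \<Turnstile> \<phi>"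
      by (auto simp: \<eta> is_run_Cons is_run_Nil)
    then have "is_run \<phi> \<eta> [\<phi>, \<psi>] [\<alpha>] \<and> [letter_of ([\<alpha>] ! 0)] \<Turnstile> [\<phi>, \<psi>] ! 0"
      by simp
    then show ?L by blast
  qed
  then show ?case using \<eta> sat_singleton_iff_NF by blast
next
  case (Suc n)
  then obtain \<omega> \<eta>' where \<eta>: "\<eta> = \<omega> # \<eta>'" and len: "length \<eta>' = n + 1"
    by (auto simp: length_Suc_conv)
  then have "\<eta>' \<noteq> []" by auto
  have hd_run: "hd s = \<psi>" if "is_run \<psi> \<eta>' s \<alpha>" for \<psi> s \<alpha>
    using that by (cases s) (auto simp: is_run_def)
  have "\<eta> \<Turnstile> \<phi> \<longleftrightarrow> (\<exists>a \<psi>. (a, \<psi>) \<in> NF \<phi> \<and> [\<omega>] \<Turnstile> a \<and> \<eta>' \<Turnstile> \<psi>)"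
    unfolding \<eta> by (rule sat_Cons_iff_NF) fact
  also have "\<dots> \<longleftrightarrow> (\<exists>a \<psi>. (a, \<psi>) \<in> NF \<phi> \<and> [\<omega>] \<Turnstile> a \<and>
      (\<exists>s \<alpha>. is_run \<psi> \<eta>' s \<alpha> \<and> [letter_of (\<alpha> ! n)] \<Turnstile> s ! n))"
    by (simp only: Suc.IH[OF len])
  also have "\<dots> \<longleftrightarrow> (\<exists>s \<alpha>. is_run \<phi> \<eta> s \<alpha> \<and> [letter_of (\<alpha> ! Suc n)] \<Turnstile> s ! Suc n)"
    (is "?L \<longleftrightarrow> ?R")
  proof
    assume ?L
    then obtain a \<psi> s \<alpha> where *: "(a, \<psi>) \<in> NF \<phi>" "[\<omega>] \<Turnstile> a"
      "is_run \<psi> \<eta>' s \<alpha>" "[letter_of (\<alpha> ! n)] \<Turnstile> s ! n"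
      by blast
    with hd_run have "is_run \<phi> \<eta> (\<phi> # s) (a # \<alpha>)"
      by (auto simp: \<eta> is_run_Cons)
    moreover have "[letter_of ((a # \<alpha>) ! Suc n)] \<Turnstile> (\<phi> # s) ! Suc n"
      using * by simp
    ultimately show ?R by blast
  next
    assume ?R
    then obtain s a \<alpha> where "(a, hd s) \<in> NF \<phi>" "[\<omega>] \<Turnstile> a"
      "is_run (hd s) \<eta>' s \<alpha>" "[letter_of (\<alpha> ! n)] \<Turnstile> s ! n"
      by (auto simp: \<eta> is_run_Cons)
    then show ?L by blast
  qed
  finally show ?case .
qed

text \<open>Extending and truncating runs translate between an accepting final transition and
  reachability of its source.\<close>

lemma is_run_snoc:
  "is_run \<phi> \<eta> s \<alpha> \<Longrightarrow> (a, \<psi>) \<in> NF (last s) \<Longrightarrow> [\<omega>] \<Turnstile> a \<Longrightarrow>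
     is_run \<phi> (\<eta> @ [\<omega>]) (s @ [\<psi>]) (\<alpha> @ [a])"
  by (cases s rule: rev_cases) (auto simp: is_run_iff_NF nth_append less_Suc_eq dest: Suc_lessD)

lemma is_run_take:
  "is_run \<phi> \<eta> s \<alpha> \<Longrightarrow> n \<le> length \<eta> \<Longrightarrow> is_run \<phi> (take n \<eta>) (take (n + 1) s) (take n \<alpha>)"
  by (auto simp: is_run_def)

section \<open>Atoms of states and labels stay within \<open>P\<close>\<close>

lemma set_ltlf_DF: "\<psi> \<in> DF \<phi> \<Longrightarrow> set_ltlf \<psi> \<subseteq> set_ltlf \<phi>"
  by (induction \<phi> rule: DF.induct) auto

lemma set_ltlf_NF: "(\<alpha>, \<psi>) \<in> NF \<phi> \<Longrightarrow> set_ltlf \<alpha> \<union> set_ltlf \<psi> \<subseteq> set_ltlf \<phi>"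
proof (induction \<phi> arbitrary: \<alpha> \<psi> rule: NF.induct)
  case (6 \<phi>1 \<phi>2)
  then show ?case by (simp only: NF.simps(6)) fastforce
next
  case (7 \<phi>1 \<phi>2)
  then show ?case by (simp only: NF.simps(7)) fastforce
next
  case (8 \<phi>1 \<phi>2)
  then show ?case by fastforce
next
  case (9 \<phi>1 \<phi>2)
  then show ?case by fastforce
qed (auto dest: set_ltlf_DF)

lemma states_formulas: "\<psi> \<in> states \<phi> \<Longrightarrow> \<phi> \<in> formulas P \<Longrightarrow> \<psi> \<in> formulas P"
  by (induction rule: states.induct) (auto simp: formulas_def dest: set_ltlf_NF)

lemma literal_in_literals: "set_literal l \<subseteq> P \<Longrightarrow> l \<in> literals P"
  by (cases l) (auto simp: literals_def)

text \<open>Letters may contain complementary literals, so only the atoms of \<open>\<alpha>\<close>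
  have to be checked.\<close>

lemma letter_of_in_letters: "\<alpha> \<in> formulas P \<Longrightarrow> letter_of \<alpha> \<in> letters P"
proof (induction \<alpha>)
  case (And \<alpha>1 \<alpha>2)
  then show ?case by (auto simp: formulas_def letters_def)
next
  case (Lit l)
  then show ?case by (simp add: formulas_def letters_def literal_in_literals)
qed (auto simp: letter_of_def letters_def)

lemma label_in_letters:
  assumes "\<phi> \<in> formulas P" and "transition \<phi> \<psi>1 \<alpha> \<psi>2"
  shows "letter_of \<alpha> \<in> letters P"
proof (rule letter_of_in_letters)
  have "\<psi>1 \<in> formulas P" "(\<alpha>, \<psi>2) \<in> NF \<psi>1"
    using assms by (auto simp: transition_def states_formulas)
  then show "\<alpha> \<in> formulas P"
    using set_ltlf_NF by (fastforce simp: formulas_def)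
qed

section \<open>Reachability and satisfiability\<close>

lemma reachable_iff_run:
  "reachable P \<phi> \<psi> \<longleftrightarrow> (\<exists>\<eta> s \<alpha>. set \<eta> \<subseteq> letters P \<and> is_run \<phi> \<eta> s \<alpha> \<and> last s = \<psi>)"
proof
  assume "reachable P \<phi> \<psi>"
  then show "\<exists>\<eta> s \<alpha>. set \<eta> \<subseteq> letters P \<and> is_run \<phi> \<eta> s \<alpha> \<and> last s = \<psi>"
    unfolding reachable_def traces_def
  proof (elim disjE)
    \<comment> \<open>Reachability of \<open>\<phi>\<close> from itself becomes the run on the empty
      word, which is not a trace.\<close>
    assume "\<psi> = \<phi>"
    then have "set [] \<subseteq> letters P \<and> is_run \<phi> [] [\<phi>] [] \<and> last [\<phi>] = \<psi>"
      by (simp add: is_run_Nil)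
    then show ?thesis by blast
  qed blast
next
  assume "\<exists>\<eta> s \<alpha>. set \<eta> \<subseteq> letters P \<and> is_run \<phi> \<eta> s \<alpha> \<and> last s = \<psi>"
  then obtain \<eta> s \<alpha> where *: "set \<eta> \<subseteq> letters P" "is_run \<phi> \<eta> s \<alpha>" "last s = \<psi>" by blast
  show "reachable P \<phi> \<psi>"
  proof (cases "\<eta> = []")
    case True
    with * show ?thesis by (simp add: reachable_def is_run_Nil)
  next
    case False
    with * show ?thesis by (auto simp: reachable_def traces_def)
  qed
qed

lemma satisfiable_iff_reachable:
  assumes "\<phi> \<in> formulas P"
  shows "satisfiable P \<phi> \<longleftrightarrow>
    (\<exists>\<psi>1 \<alpha> \<psi>2. reachable P \<phi> \<psi>1 \<and> transition \<phi> \<psi>1 \<alpha> \<psi>2 \<and> [letter_of \<alpha>] \<Turnstile> \<psi>1)"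
proof
  assume "satisfiable P \<phi>"
  then obtain \<eta> where \<eta>: "set \<eta> \<subseteq> letters P" "\<eta> \<noteq> []" "\<eta> \<Turnstile> \<phi>"
    by (auto simp: satisfiable_def traces_def)
  then obtain n where n: "length \<eta> = n + 1"
    by (cases \<eta>) auto
  with \<eta>(3) sat_iff_run obtain s \<alpha> where
    run: "is_run \<phi> \<eta> s \<alpha>" and fin: "[letter_of (\<alpha> ! n)] \<Turnstile> s ! n"
    by blast
  \<comment> \<open>Without its last letter the run ends in \<open>s ! n\<close>, the source of the
    final transition; for \<open>n = 0\<close> this is the empty run.\<close>
  have "set (take n \<eta>) \<subseteq> letters P"
    using \<eta>(1) set_take_subset by fast
  moreover have "last (take (n + 1) s) = s ! n"
    using run n by (simp add: is_run_def take_Suc_conv_app_nth)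
  ultimately have "reachable P \<phi> (s ! n)"
    using is_run_take[OF run, of n] n unfolding reachable_iff_run by force
  moreover have "transition \<phi> (s ! n) (\<alpha> ! n) (s ! (n + 1))"
    using run n by (simp add: is_run_def)
  ultimately show "\<exists>\<psi>1 \<alpha> \<psi>2. reachable P \<phi> \<psi>1 \<and> transition \<phi> \<psi>1 \<alpha> \<psi>2 \<and> [letter_of \<alpha>] \<Turnstile> \<psi>1"
    using fin by blast
next
  assume "\<exists>\<psi>1 \<alpha> \<psi>2. reachable P \<phi> \<psi>1 \<and> transition \<phi> \<psi>1 \<alpha> \<psi>2 \<and> [letter_of \<alpha>] \<Turnstile> \<psi>1"
  then obtain \<eta> s \<alpha> a \<psi> where
    \<eta>: "set \<eta> \<subseteq> letters P" and run: "is_run \<phi> \<eta> s \<alpha>" and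
    trans: "transition \<phi> (last s) a \<psi>" and fin: "[letter_of a] \<Turnstile> last s"
    unfolding reachable_iff_run by blast
  \<comment> \<open>The label's own letter is the least one satisfying it.\<close>
  let ?\<eta> = "\<eta> @ [letter_of a]"
  have "(a, \<psi>) \<in> NF (last s)"
    using trans by (simp add: transition_def)
  then have "is_run \<phi> ?\<eta> (s @ [\<psi>]) (\<alpha> @ [a])"
    using run by (simp add: is_run_snoc sat_label_iff)
  \<comment> \<open>A run has one more state than labels, so this index hits the old last state but
    the new label.\<close>
  moreover have "(s @ [\<psi>]) ! length \<eta> = last s" "(\<alpha> @ [a]) ! length \<eta> = a"
    using run by (cases s rule: rev_cases; auto simp: is_run_def nth_append)+
  ultimately have "\<exists>s \<alpha>. is_run \<phi> ?\<eta> s \<alpha> \<and> [letter_of (\<alpha> ! length \<eta>)] \<Turnstile> s ! length \<eta>"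
    using fin by metis
  then have "?\<eta> \<Turnstile> \<phi>"
    using sat_iff_run[of ?\<eta> "length \<eta>" \<phi>] by simp
  moreover have "?\<eta> \<in> traces P"
    using \<eta> label_in_letters[OF assms trans] by (simp add: traces_def)
  ultimately show "satisfiable P \<phi>"
    by (auto simp: satisfiable_def)
qed

theorem theorem2:
  fixes P :: "'a set" and \<phi> :: "'a ltlf"
  assumes "finite P" and "\<phi> \<in> formulas P"
  shows "(\<forall>n \<eta>. \<eta> \<in> traces P \<and> length \<eta> = n + 1 \<longrightarrow>
            (\<eta> \<Turnstile> \<phi> \<longleftrightarrow> (\<exists>s \<alpha>. is_run \<phi> \<eta> s \<alpha> \<and> [letter_of (\<alpha> ! n)] \<Turnstile> s ! n))) \<and>
         (satisfiable P \<phi> \<longleftrightarrow>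
            (\<exists>\<psi>1 \<alpha> \<psi>2. reachable P \<phi> \<psi>1 \<and> transition \<phi> \<psi>1 \<alpha> \<psi>2 \<and> [letter_of \<alpha>] \<Turnstile> \<psi>1))"
  using sat_iff_run satisfiable_iff_reachable[OF assms(2)] by blast

end
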